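(* Let $(D,G_o)$ be a two-sender unicast index-coding problem with a fully participated interaction between its sub-digraphs $D_1,D_2,D_3$. Suppose that $f(D)$ contains all four arcs $(1,3),(3,1),(2,3),(3,2)$ (with arbitrary arcs between $1$ and $2$). Then for every $t\ge1$, $$\beta_t(D,G_o)=\max\{\beta_t(D_3),\ \beta_t(D_1)+\beta_t(D_2)\},$$ and $$\beta(D,G_o)=\max\{\beta(D_3),\ \beta(D_1)+\beta(D_2)\}.$$
   Context: There are $N$ messages $\mathcal{M}=\{x_1,\dots,x_N\}$, $x_i\in\{0,1\}^t$, and $N$ receivers; receiver $r$ requests $x_r$ and knows $\{x_j: j\in N_D^+(r)\}$, where $D$ is a loopless digraph on $V(D)=\{1,\dots,N\}$ (the side-information digraph) and $N_D^+(r)$ is the out-neighborhood of $r$. Single sender: an index code is an encoding function of all messages into $\{0,1\}^p$ together with decoding functions by which every receiver $r$ recovers $x_r$, for all message realizations, from the codeword and its side information. $\beta_t(D)$ is the minimum of $p/t$ over index codes for $t$-bit messages, and $\beta(D)=\inf_t\beta_t(D)=\lim_{t\to\infty}\beta_t(D)$. Two senders: senders $S_1,S_2$ know $\mathcal{M}_1,\mathcal{M}_2$ with $\mathcal{M}_1\cup\mathcal{M}_2=\mathcal{M}$. A two-sender index code consists of encoding functions $\mathscr{F}_s:\{0,1\}^{|\mathcal{M}_s|t}\to\{0,1\}^{p_s}$, $s=1,2$ ($p_s\ge0$ an integer), and decoding functions by which every receiver $r$ recovers $x_r$, for all message realizations, from both sub-codewords and its side information. $\beta_t(D,G_o)$ is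 the minimum of $(p_1+p_2)/t$ over two-sender index codes for $t$-bit messages, and $\beta(D,G_o)=\inf_t\beta_t(D,G_o)=\lim_{t\to\infty}\beta_t(D,G_o)$. Here $G_o$ (the sender-constraint graph, with vertex set $V(D)$ and an edge $ij$ iff one of $x_i,x_j$ is in $\mathcal{M}_1\setminus\mathcal{M}_2$ and the other in $\mathcal{M}_2\setminus\mathcal{M}_1$) records the senders' message sets. Let $\mathcal{P}_1=\mathcal{M}_1\setminus\mathcal{M}_2$, $\mathcal{P}_2=\mathcal{M}_2\setminus\mathcal{M}_1$, $\mathcal{P}_3=\mathcal{M}_1\cap\mathcal{M}_2$. For $i\in\{1,2,3\}$, $D_i$ is the sub-digraph of $D$ induced by $\{j:x_j\in\mathcal{P}_i\}$. The digraph $f(D)$ has vertex set $\{1,2,3\}$, and $(i,j)$, $i\neq j$, is an arc of $f(D)$ iff there is an arc of $D$ from some vertex of $D_i$ to some vertex of $D_j$. The interaction is fully participated if, whenever $(i,j)$ is an arc of $f(D)$, every vertex of $D_i$ has arcs to all vertices of $D_j$. *)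

theory Defs
  imports Complex_Main "HOL-Library.FuncSet" "Graph_Theory.Graph_Theory"
begin

definition words :: "nat \<Rightarrow> bool list set" where
  "words n = {w. length w = n}"

text \<open>Messages are identified with their indices, i.e. with the vertices of the digraph.
  A realization of the messages in \<open>S\<close> is an element of \<open>realizations S t\<close>, and restricting
  it to a subset of \<open>S\<close> yields the realization of that subset.\<close>

definition realizations :: "'v set \<Rightarrow> nat \<Rightarrow> ('v \<Rightarrow> bool list) set" where
  "realizations S t = (S \<rightarrow>\<^sub>E words t)"

definition out_nbhd :: "('v, 'e) pre_digraph \<Rightarrow> 'v \<Rightarrow> 'v set" where
  "out_nbhd D r = {j. r \<rightarrow>\<^bsub>D\<^esub> j}"

definition index_code ::
  "('v, 'e) pre_digraph \<Rightarrow> nat \<Rightarrow> nat \<Rightarrow> (('v \<Rightarrow> bool list) \<Rightarrow> bool list) \<Rightarrow>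
   ('v \<Rightarrow> bool list \<Rightarrow> ('v \<Rightarrow> bool list) \<Rightarrow> bool list) \<Rightarrow> bool" where
  "index_code D t p enc dec \<longleftrightarrow>
     enc \<in> realizations (verts D) t \<rightarrow> words p \<and>
     (\<forall>x \<in> realizations (verts D) t. \<forall>r \<in> verts D.
        dec r (enc x) (restrict x (out_nbhd D r)) = x r)"

text \<open>For fixed \<open>t\<close>, minimizing \<open>p / t\<close> is minimizing the length \<open>p\<close>. The minimum exists
  for finite digraphs, since sending all messages uncoded is an index code. For the null
  digraph it is \<open>0\<close>.\<close>

definition beta_t :: "nat \<Rightarrow> ('v, 'e) pre_digraph \<Rightarrow> real" where
  "beta_t t D = real (LEAST p. \<exists>enc dec. index_code D t p enc dec) / real t"

definition beta :: "('v, 'e) pre_digraph \<Rightarrow> real" where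
  "beta D = (INF t\<in>{1..}. beta_t t D)"

text \<open>The two senders are given by their sets \<open>M1\<close> and \<open>M2\<close> of message indices. These carry
  the data recorded by the sender-constraint graph, whose edges are the pairs with one
  vertex in \<open>M1 - M2\<close> and the other in \<open>M2 - M1\<close>.\<close>

definition two_sender_index_code ::
  "('v, 'e) pre_digraph \<Rightarrow> 'v set \<Rightarrow> 'v set \<Rightarrow> nat \<Rightarrow> nat \<Rightarrow> nat \<Rightarrow>
   (('v \<Rightarrow> bool list) \<Rightarrow> bool list) \<Rightarrow> (('v \<Rightarrow> bool list) \<Rightarrow> bool list) \<Rightarrow>
   ('v \<Rightarrow> bool list \<Rightarrow> bool list \<Rightarrow> ('v \<Rightarrow> bool list) \<Rightarrow> bool list) \<Rightarrow> bool" where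
  "two_sender_index_code D M1 M2 t p1 p2 enc1 enc2 dec \<longleftrightarrow>
     enc1 \<in> realizations M1 t \<rightarrow> words p1 \<and>
     enc2 \<in> realizations M2 t \<rightarrow> words p2 \<and>
     (\<forall>x \<in> realizations (verts D) t. \<forall>r \<in> verts D.
        dec r (enc1 (restrict x M1)) (enc2 (restrict x M2)) (restrict x (out_nbhd D r)) = x r)"

definition beta2_t :: "nat \<Rightarrow> ('v, 'e) pre_digraph \<Rightarrow> 'v set \<Rightarrow> 'v set \<Rightarrow> real" where
  "beta2_t t D M1 M2 =
     real (LEAST p. \<exists>p1 p2 enc1 enc2 dec.
             p = p1 + p2 \<and> two_sender_index_code D M1 M2 t p1 p2 enc1 enc2 dec) / real t"

definition beta2 :: "('v, 'e) pre_digraph \<Rightarrow> 'v set \<Rightarrow> 'v set \<Rightarrow> real" where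
  "beta2 D M1 M2 = (INF t\<in>{1..}. beta2_t t D M1 M2)"

definition part :: "'v set \<Rightarrow> 'v set \<Rightarrow> nat \<Rightarrow> 'v set" where
  "part M1 M2 i = (if i = 1 then M1 - M2 else if i = 2 then M2 - M1 else M1 \<inter> M2)"

definition sub_digraph ::
  "('v, 'e) pre_digraph \<Rightarrow> 'v set \<Rightarrow> 'v set \<Rightarrow> nat \<Rightarrow> ('v, 'e) pre_digraph" where
  "sub_digraph D M1 M2 i = D \<restriction> part M1 M2 i"

definition interaction_digraph ::
  "('v, 'e) pre_digraph \<Rightarrow> 'v set \<Rightarrow> 'v set \<Rightarrow> nat pair_pre_digraph" where
  "interaction_digraph D M1 M2 =
     \<lparr> pverts = {1, 2, 3},
       parcs = {(i, j). i \<in> {1, 2, 3} \<and> j \<in> {1, 2, 3} \<and> i \<noteq> j \<and>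
         (\<exists>u \<in> verts (sub_digraph D M1 M2 i). \<exists>v \<in> verts (sub_digraph D M1 M2 j). u \<rightarrow>\<^bsub>D\<^esub> v)} \<rparr>"

definition fully_participated :: "('v, 'e) pre_digraph \<Rightarrow> 'v set \<Rightarrow> 'v set \<Rightarrow> bool" where
  "fully_participated D M1 M2 \<longleftrightarrow>
     (\<forall>(i, j) \<in> parcs (interaction_digraph D M1 M2).
        \<forall>u \<in> verts (sub_digraph D M1 M2 i). \<forall>v \<in> verts (sub_digraph D M1 M2 j). u \<rightarrow>\<^bsub>D\<^esub> v)"

end

theory Submission
  imports Defs
begin

text \<open>Both identities rest on the minimal codeword lengths \<open>n\<^sub>1, n\<^sub>2, n\<^sub>3\<close> of the three parts.
  For achievability, a codeword of \<open>D\<^sub>3\<close> is split between the two senders and added modulo two to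
  the codewords of \<open>D\<^sub>1\<close> and \<open>D\<^sub>2\<close>: the receivers of \<open>D\<^sub>1\<close> and \<open>D\<^sub>2\<close> know all messages of \<open>D\<^sub>3\<close> and
  conversely, so everybody can strip off the summand it does not need. For the converse, freezing
  the messages outside \<open>D\<^sub>3\<close> gives a code for \<open>D\<^sub>3\<close> of length \<open>p\<^sub>1 + p\<^sub>2\<close>, and freezing those outside
  \<open>D\<^sub>1\<close> makes the second sub-codeword constant, so \<open>p\<^sub>1 \<ge> n\<^sub>1\<close>; likewise \<open>p\<^sub>2 \<ge> n\<^sub>2\<close>. The asymptotic
  identity follows because concatenating codes gives \<open>\<beta>\<^sub>k\<^sub>t \<le> \<beta>\<^sub>t\<close>, so that near-optimal values of
  \<open>t\<close> for the three parts can be replaced by their product.\<close>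

section \<open>Single-sender codes: existence, padding and concatenation\<close>

definition min_length :: "nat \<Rightarrow> ('v, 'e) pre_digraph \<Rightarrow> nat" where
  "min_length t D = (LEAST p. \<exists>enc dec. index_code D t p enc dec)"

lemma beta_t_eq: "beta_t t D = real (min_length t D) / real t"
  by (simp add: beta_t_def min_length_def)

lemma min_length_le: "index_code D t p enc dec \<Longrightarrow> min_length t D \<le> p"
  unfolding min_length_def by (rule Least_le) blast

lemma finite_words: "finite (words n)"
  using finite_lists_length_eq[of "UNIV :: bool set" n] by (simp add: words_def)

text \<open>One-hot coding: the elements are numbered, and each is sent to the indicator word of its
  number. The length \<open>card A\<close> is wasteful, but only existence matters.\<close>

lemma ex_inj_into_words:
  assumes "finite A"
  shows "\<exists>p f. f \<in> A \<rightarrow> words p \<and> inj_on f A"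
proof -
  obtain h where h: "bij_betw h A {0..<card A}"
    using ex_bij_betw_finite_nat[OF assms] by blast
  define f where "f x = map (\<lambda>i. i = h x) [0..<card A]" for x
  have "inj_on f A"
  proof (rule inj_onI)
    fix x y assume xy: "x \<in> A" "y \<in> A" "f x = f y"
    then have lt: "h x < card A"
      using h by (auto simp: bij_betw_def)
    then have "f x ! h x = f y ! h x"
      using xy by simp
    then have "h x = h y"
      using lt by (simp add: f_def)
    then show "x = y"
      using xy h by (auto simp: bij_betw_def inj_on_def)
  qed
  moreover have "f \<in> A \<rightarrow> words (card A)"
    by (auto simp: f_def words_def)
  ultimately show ?thesis by blast
qed

text \<open>The \<open>LEAST\<close> in \<open>min_length\<close> is attained only if some code
  exists. An injective encoding of the finitely many realizations is one: every receiver inverts it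
  and reads off its own message.\<close>

lemma ex_index_code:
  assumes "finite (verts D)"
  shows "\<exists>p enc dec. index_code D t p enc dec"
proof -
  let ?R = "realizations (verts D) t"
  have "finite ?R"
    unfolding realizations_def by (intro finite_PiE assms finite_words)
  then obtain p f where f: "f \<in> ?R \<rightarrow> words p" "inj_on f ?R"
    using ex_inj_into_words by blast
  then have "index_code D t p f (\<lambda>r w y. inv_into ?R f w r)"
    by (simp add: index_code_def)
  then show ?thesis by blast
qed

lemma ex_index_code_min_length:
  assumes "finite (verts D)"
  shows "\<exists>enc dec. index_code D t (min_length t D) enc dec"
  unfolding min_length_def by (rule LeastI_ex) (rule ex_index_code[OF assms])

text \<open>Padding bits are appended by the encoder and cut off by the decoder. This allows the
  lengths of the codes for the three parts to be matched to each other.\<close>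

lemma index_code_pad:
  assumes "index_code D t p enc dec" "p \<le> q"
  shows "\<exists>enc dec. index_code D t q enc dec"
proof -
  have "length (enc x) = p" if "x \<in> realizations (verts D) t" for x
    using assms(1) that by (auto simp: index_code_def words_def)
  then have "index_code D t q (\<lambda>x. enc x @ replicate (q - p) False) (\<lambda>r w. dec r (take p w))"
    using assms by (auto simp: index_code_def words_def Pi_iff)
  then show ?thesis by blast
qed

text \<open>Each message is cut after its first \<open>s\<close> bits; the two pieces are encoded
  separately and the codewords concatenated.\<close>

lemma index_code_append:
  assumes 1: "index_code D s p enc1 dec1" and 2: "index_code D t q enc2 dec2"
  shows "\<exists>enc dec. index_code D (s + t) (p + q) enc dec"
proof -
  let ?V = "verts D"
  define A where "A x = restrict (\<lambda>v. take s (x v)) ?V" for x :: "'a \<Rightarrow> bool list"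
  define B where "B x = restrict (\<lambda>v. drop s (x v)) ?V" for x :: "'a \<Rightarrow> bool list"
  define enc where "enc x = enc1 (A x) @ enc2 (B x)" for x
  define dec where "dec r w y = dec1 r (take p w) (restrict (A y) (out_nbhd D r)) @
    dec2 r (drop p w) (restrict (B y) (out_nbhd D r))" for r w y
  have A: "A x \<in> realizations ?V s" and B: "B x \<in> realizations ?V t"
    if "x \<in> realizations ?V (s + t)" for x
    using that by (auto simp: A_def B_def realizations_def words_def PiE_iff)
  \<comment> \<open>A receiver can only cut the messages it knows. Cutting and then restricting
    again to its neighbourhood gives exactly the side information that \<open>dec1\<close> and
    \<open>dec2\<close> expect.\<close>
  have rA: "restrict (A (restrict x S)) S = restrict (A x) S"
    and rB: "restrict (B (restrict x S)) S = restrict (B x) S" for x S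
    by (auto simp: A_def B_def restrict_def fun_eq_iff)
  have l1: "length (enc1 x) = p" if "x \<in> realizations ?V s" for x
    using 1 that by (auto simp: index_code_def words_def)
  have l2: "length (enc2 x) = q" if "x \<in> realizations ?V t" for x
    using 2 that by (auto simp: index_code_def words_def)
  have "dec r (enc x) (restrict x (out_nbhd D r)) = x r"
    if x: "x \<in> realizations ?V (s + t)" and r: "r \<in> ?V" for x r
  proof -
    have "dec1 r (enc1 (A x)) (restrict (A x) (out_nbhd D r)) = A x r"
      "dec2 r (enc2 (B x)) (restrict (B x) (out_nbhd D r)) = B x r"
      using 1 2 A[OF x] B[OF x] r by (auto simp: index_code_def)
    then show ?thesis
      using r by (simp add: dec_def enc_def l1[OF A[OF x]] rA rB) (simp add: A_def B_def)
  qed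
  moreover have "enc \<in> realizations ?V (s + t) \<rightarrow> words (p + q)"
    using A B l1 l2 by (auto simp: enc_def words_def)
  ultimately have "index_code D (s + t) (p + q) enc dec"
    by (simp add: index_code_def)
  then show ?thesis by blast
qed

lemma min_length_add_le:
  assumes "finite (verts D)"
  shows "min_length (s + t) D \<le> min_length s D + min_length t D"
  by (meson assms ex_index_code_min_length index_code_append min_length_le)

lemma min_length_mult_le:
  assumes "finite (verts D)" "k \<ge> 1"
  shows "min_length (k * t) D \<le> k * min_length t D"
  using assms(2)
proof (induction k rule: nat_induct_at_least)
  case base
  then show ?case by simp
next
  case (Suc k)
  then show ?case
    using min_length_add_le[OF assms(1), of t "k * t"] by simp
qed

section \<open>From fixed message length to the infimum\<close>

lemma beta_t_mult_le:
  assumes "finite (verts D)" "k \<ge> 1" "t \<ge> 1"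
  shows "beta_t (k * t) D \<le> beta_t t D"
proof -
  have "real (min_length (k * t) D) \<le> real k * real (min_length t D)"
    using min_length_mult_le[OF assms(1,2)] by (metis of_nat_le_iff of_nat_mult)
  then show ?thesis
    using assms(2,3) by (simp add: beta_t_eq field_simps)
qed

text \<open>In general an infimum of sums or maxima may exceed the sum or maximum of the infima, as
  the near-optimal arguments may differ. Here passing to a multiple never increases a value, so one
  common multiple serves all three functions.\<close>

lemma INF_max_add_eq:
  fixes a b c :: "nat \<Rightarrow> real"
  assumes nonneg: "\<And>t. 0 \<le> a t" "\<And>t. 0 \<le> b t" "\<And>t. 0 \<le> c t"
    and mult: "\<And>k t. k \<ge> 1 \<Longrightarrow> t \<ge> 1 \<Longrightarrow> a (k * t) \<le> a t"
      "\<And>k t. k \<ge> 1 \<Longrightarrow> t \<ge> 1 \<Longrightarrow> b (k * t) \<le> b t"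
      "\<And>k t. k \<ge> 1 \<Longrightarrow> t \<ge> 1 \<Longrightarrow> c (k * t) \<le> c t"
  shows "(INF t\<in>{1..}. max (a t) (b t + c t)) =
    max (INF t\<in>{1..}. a t) ((INF t\<in>{1..}. b t) + (INF t\<in>{1..}. c t))"
    (is "?I = max ?a (?b + ?c)")
proof (rule antisym)
  have bdd: "bdd_below (f ` {1..})" if "\<And>t. 0 \<le> f t" for f :: "nat \<Rightarrow> real"
    using that by (auto intro: bdd_belowI[of _ 0])
  have low: "?a \<le> a t" "?b \<le> b t" "?c \<le> c t" if "t \<ge> 1" for t
    using that by (auto intro!: cINF_lower bdd nonneg)
  show "max ?a (?b + ?c) \<le> ?I"
  proof (rule cINF_greatest)
    fix t :: nat assume "t \<in> {1..}"
    then show "max ?a (?b + ?c) \<le> max (a t) (b t + c t)"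
      using low[of t] by auto
  qed simp
  show "?I \<le> max ?a (?b + ?c)"
  proof (rule field_le_epsilon)
    fix e :: real assume e: "0 < e"
    \<comment> \<open>The error is \<open>e / 2\<close> because two of these errors add up in
      \<open>b + c\<close>.\<close>
    have near: "\<exists>t\<ge>1. f t < (INF t\<in>{1..}. f t) + e / 2" if "\<And>t. 0 \<le> f t" for f :: "nat \<Rightarrow> real"
      using cINF_less_iff[of "{1..}" f "(INF t\<in>{1..}. f t) + e / 2", OF _ bdd[OF that]] e by auto
    obtain i j k where ijk: "i \<ge> 1" "j \<ge> 1" "k \<ge> 1"
      and lt: "a i < ?a + e / 2" "b j < ?b + e / 2" "c k < ?c + e / 2"
      using near nonneg by metis
    let ?t = "i * j * k"
    have t: "?t \<ge> 1"
      using ijk by simp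
    have "a ?t \<le> a i" "b ?t \<le> b j" "c ?t \<le> c k"
      using mult(1)[of "j * k" i] mult(2)[of "i * k" j] mult(3)[of "i * j" k] ijk
      by (simp_all add: mult_ac)
    then have "max (a ?t) (b ?t + c ?t) \<le> max ?a (?b + ?c) + e"
      using lt e by (simp add: max_def)
    moreover have "?I \<le> max (a ?t) (b ?t + c ?t)"
      using t by (intro cINF_lower bdd) (auto simp: nonneg le_max_iff_disj)
    ultimately show "?I \<le> max ?a (?b + ?c) + e"
      by linarith
  qed
qed

section \<open>Freezing messages, and the lower bound\<close>

lemma out_nbhd_induce_subgraph:
  "r \<in> A \<Longrightarrow> out_nbhd (D \<restriction> A) r = out_nbhd D r \<inter> A"
  unfolding out_nbhd_def arcs_ends_conv image_iff set_eq_iff by auto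

text \<open>Messages outside \<open>A\<close> are frozen at the zero word. The outer
  \<open>restrict\<close> makes the result extensional on \<open>V\<close>, as membership in
  \<open>realizations\<close> demands.\<close>

definition zero_extend :: "'v set \<Rightarrow> 'v set \<Rightarrow> nat \<Rightarrow> ('v \<Rightarrow> bool list) \<Rightarrow> 'v \<Rightarrow> bool list" where
  "zero_extend V A t x = restrict (\<lambda>v. if v \<in> A then x v else replicate t False) V"

lemma zero_extend_realizations:
  "x \<in> realizations A t \<Longrightarrow> zero_extend V A t x \<in> realizations V t"
  by (auto simp: zero_extend_def realizations_def words_def PiE_iff)

text \<open>Frozen messages are known constants, so a receiver of the induced sub-digraph can
  reconstruct the side information it would have in the whole digraph.\<close>

lemma restrict_zero_extend_restrict:
  "restrict (zero_extend V A t (restrict x (S \<inter> A))) S = restrict (zero_extend V A t x) S"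
  by (auto simp: zero_extend_def restrict_def fun_eq_iff)

lemma restrict_realizations:
  "x \<in> realizations V t \<Longrightarrow> A \<subseteq> V \<Longrightarrow> restrict x A \<in> realizations A t"
  by (auto simp: realizations_def)

lemma two_sender_index_codeD:
  assumes "two_sender_index_code D M1 M2 t p1 p2 enc1 enc2 dec" "M1 \<union> M2 = verts D"
    and "x \<in> realizations (verts D) t"
  shows "enc1 (restrict x M1) \<in> words p1" "enc2 (restrict x M2) \<in> words p2"
    and "r \<in> verts D \<Longrightarrow>
      dec r (enc1 (restrict x M1)) (enc2 (restrict x M2)) (restrict x (out_nbhd D r)) = x r"
proof -
  have "restrict x M1 \<in> realizations M1 t" "restrict x M2 \<in> realizations M2 t"
    using assms(2) by (intro restrict_realizations[OF assms(3)]; blast)+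
  then show "enc1 (restrict x M1) \<in> words p1" "enc2 (restrict x M2) \<in> words p2"
    and "r \<in> verts D \<Longrightarrow>
      dec r (enc1 (restrict x M1)) (enc2 (restrict x M2)) (restrict x (out_nbhd D r)) = x r"
    using assms(1,3) unfolding two_sender_index_code_def by (blast intro: funcset_mem)+
qed

lemma two_sender_index_code_induce:
  assumes code: "two_sender_index_code D M1 M2 t p1 p2 enc1 enc2 dec"
    and M: "M1 \<union> M2 = verts D" and A: "A \<subseteq> verts D"
  shows "\<exists>enc dec. index_code (D \<restriction> A) t (p1 + p2) enc dec"
proof -
  let ?z = "zero_extend (verts D) A t"
  define enc where "enc x = enc1 (restrict (?z x) M1) @ enc2 (restrict (?z x) M2)" for x
  define dec' where "dec' r w y = dec r (take p1 w) (drop p1 w) (restrict (?z y) (out_nbhd D r))"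
    for r w y
  have w: "enc1 (restrict (?z x) M1) \<in> words p1" "enc2 (restrict (?z x) M2) \<in> words p2"
    if "x \<in> realizations A t" for x
    using two_sender_index_codeD(1,2)[OF code M zero_extend_realizations[OF that]] .
  have "dec' r (enc x) (restrict x (out_nbhd (D \<restriction> A) r)) = x r"
    if x: "x \<in> realizations A t" and r: "r \<in> A" for x r
  proof -
    have "dec r (enc1 (restrict (?z x) M1)) (enc2 (restrict (?z x) M2))
        (restrict (?z x) (out_nbhd D r)) = ?z x r"
      using two_sender_index_codeD(3)[OF code M zero_extend_realizations[OF x]] r A by blast
    moreover have "?z x r = x r"
      using r A by (auto simp: zero_extend_def)
    ultimately show ?thesis
      using w[OF x]
      by (simp add: dec'_def enc_def words_def out_nbhd_induce_subgraph[OF r]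
          restrict_zero_extend_restrict)
  qed
  moreover have "enc \<in> realizations A t \<rightarrow> words (p1 + p2)"
    using w by (auto simp: enc_def words_def)
  ultimately have "index_code (D \<restriction> A) t (p1 + p2) enc dec'"
    by (simp add: index_code_def)
  then show ?thesis by blast
qed

text \<open>With all messages outside \<open>M1 - M2\<close> frozen, the second sender sees only
  zero words. Its sub-codeword is a constant that the decoder can contain, which leaves just the
  \<open>p1\<close> bits of the first sender.\<close>

lemma two_sender_index_code_induce_private:
  assumes code: "two_sender_index_code D M1 M2 t p1 p2 enc1 enc2 dec"
    and M: "M1 \<union> M2 = verts D"
  shows "\<exists>enc dec. index_code (D \<restriction> (M1 - M2)) t p1 enc dec"
proof -
  let ?A = "M1 - M2"
  let ?z = "zero_extend (verts D) ?A t"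
  define c where "c = enc2 (restrict (\<lambda>_. replicate t False) M2)"
  define enc where "enc x = enc1 (restrict (?z x) M1)" for x
  define dec' where "dec' r w y = dec r w c (restrict (?z y) (out_nbhd D r))" for r w y
  have c: "restrict (?z x) M2 = restrict (\<lambda>_. replicate t False) M2" for x
    using M by (auto simp: zero_extend_def restrict_def fun_eq_iff)
  have "dec' r (enc x) (restrict x (out_nbhd (D \<restriction> ?A) r)) = x r"
    if x: "x \<in> realizations ?A t" and r: "r \<in> ?A" for x r
  proof -
    have "dec r (enc1 (restrict (?z x) M1)) (enc2 (restrict (?z x) M2))
        (restrict (?z x) (out_nbhd D r)) = ?z x r"
      using two_sender_index_codeD(3)[OF code M zero_extend_realizations[OF x]] r M by blast
    moreover have "?z x r = x r"
      using r M by (auto simp: zero_extend_def)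
    ultimately show ?thesis
      by (simp add: dec'_def enc_def c_def c out_nbhd_induce_subgraph[OF r]
          restrict_zero_extend_restrict)
  qed
  moreover have "enc \<in> realizations ?A t \<rightarrow> words p1"
    using two_sender_index_codeD(1)[OF code M zero_extend_realizations]
    unfolding enc_def by blast
  ultimately have "index_code (D \<restriction> ?A) t p1 enc dec'"
    by (simp add: index_code_def)
  then show ?thesis by blast
qed

lemma two_sender_index_code_swap:
  assumes "two_sender_index_code D M1 M2 t p1 p2 enc1 enc2 dec"
  shows "two_sender_index_code D M2 M1 t p2 p1 enc2 enc1 (\<lambda>r u v. dec r v u)"
  using assms by (simp add: two_sender_index_code_def)

lemma two_sender_index_code_lower:
  assumes code: "two_sender_index_code D M1 M2 t p1 p2 enc1 enc2 dec"
    and M: "M1 \<union> M2 = verts D"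
  shows "max (min_length t (D \<restriction> (M1 \<inter> M2)))
      (min_length t (D \<restriction> (M1 - M2)) + min_length t (D \<restriction> (M2 - M1))) \<le> p1 + p2"
proof -
  have "M1 \<inter> M2 \<subseteq> verts D"
    using M by blast
  then have "min_length t (D \<restriction> (M1 \<inter> M2)) \<le> p1 + p2"
    using two_sender_index_code_induce[OF code M] min_length_le by blast
  moreover have "min_length t (D \<restriction> (M1 - M2)) \<le> p1"
    using two_sender_index_code_induce_private[OF code M] min_length_le by blast
  \<comment> \<open>The same argument with the roles of the senders exchanged.\<close>
  moreover have "min_length t (D \<restriction> (M2 - M1)) \<le> p2"
    using two_sender_index_code_induce_private[OF two_sender_index_code_swap[OF code]] M
      min_length_le by blast
  ultimately show ?thesis by simp
qed

section \<open>Achievability by adding codewords modulo two\<close>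

definition xor_words :: "bool list \<Rightarrow> bool list \<Rightarrow> bool list" where
  "xor_words u v = map2 (\<noteq>) u v"

lemma length_xor_words [simp]: "length (xor_words u v) = min (length u) (length v)"
  by (simp add: xor_words_def)

text \<open>Addition modulo two is an involution. Equal lengths are required because
  \<open>map2\<close> stops at the end of the shorter word.\<close>

lemma xor_words_cancel_right:
  "length u = length v \<Longrightarrow> xor_words (xor_words u v) v = u"
  by (auto simp: xor_words_def list_eq_iff_nth_eq)

lemma xor_words_cancel_left:
  "length u = length v \<Longrightarrow> xor_words (xor_words u v) u = v"
  by (auto simp: xor_words_def list_eq_iff_nth_eq)

text \<open>Senders and receivers work with realizations of sets larger than the part
  \<open>A\<close>; the set \<open>V\<close> becomes \<open>M1\<close>, \<open>M2\<close> or
  \<open>verts D\<close>.\<close>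

lemma index_codeD:
  assumes "index_code (D \<restriction> A) t p enc dec" "x \<in> realizations V t" "A \<subseteq> V"
  shows "length (enc (restrict x A)) = p"
    and "r \<in> A \<Longrightarrow> dec r (enc (restrict x A)) (restrict x (out_nbhd D r \<inter> A)) = x r"
proof -
  have x: "restrict x A \<in> realizations A t"
    by (rule restrict_realizations[OF assms(2,3)])
  then show "length (enc (restrict x A)) = p"
    using assms(1) by (auto simp: index_code_def words_def)
  assume r: "r \<in> A"
  have "\<forall>x\<in>realizations A t. \<forall>r\<in>A. dec r (enc x) (restrict x (out_nbhd (D \<restriction> A) r)) = x r"
    using assms(1) by (simp add: index_code_def)
  then have "dec r (enc (restrict x A)) (restrict (restrict x A) (out_nbhd (D \<restriction> A) r)) =
      restrict x A r"
    using x r by blast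
  moreover have "A \<inter> (out_nbhd D r \<inter> A) = out_nbhd D r \<inter> A"
    by blast
  ultimately show "dec r (enc (restrict x A)) (restrict x (out_nbhd D r \<inter> A)) = x r"
    using r by (simp add: out_nbhd_induce_subgraph)
qed

text \<open>The length \<open>p1 + p2\<close> of the third code lets its codeword be cut at
  \<open>p1\<close> into two pieces that fit the other two codewords. Each sender can compute its
  sum, as both senders know the common messages.\<close>

lemma two_sender_index_code_construct:
  assumes c1: "index_code (D \<restriction> (M1 - M2)) t p1 e1 d1"
    and c2: "index_code (D \<restriction> (M2 - M1)) t p2 e2 d2"
    and c3: "index_code (D \<restriction> (M1 \<inter> M2)) t (p1 + p2) e3 d3"
    and M: "M1 \<union> M2 = verts D"
    and to3: "\<And>r. r \<in> (M1 - M2) \<union> (M2 - M1) \<Longrightarrow> M1 \<inter> M2 \<subseteq> out_nbhd D r"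
    and from3: "\<And>r. r \<in> M1 \<inter> M2 \<Longrightarrow> (M1 - M2) \<union> (M2 - M1) \<subseteq> out_nbhd D r"
  shows "\<exists>enc1 enc2 dec. two_sender_index_code D M1 M2 t p1 p2 enc1 enc2 dec"
proof -
  let ?A = "M1 - M2" and ?B = "M2 - M1" and ?C = "M1 \<inter> M2"
  define enc1 where "enc1 x = xor_words (e1 (restrict x ?A)) (take p1 (e3 (restrict x ?C)))" for x
  define enc2 where "enc2 x = xor_words (e2 (restrict x ?B)) (drop p1 (e3 (restrict x ?C)))" for x
  \<comment> \<open>Each branch subtracts what the receiver can recompute from \<open>y\<close>. A
    private receiver removes its piece of the common codeword from the sub-codeword of its own
    sender; a common receiver removes both private codewords and joins the two pieces.\<close>
  define dec where "dec r w1 w2 y =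
    (if r \<in> ?A then
       d1 r (xor_words w1 (take p1 (e3 (restrict y ?C)))) (restrict y (out_nbhd D r \<inter> ?A))
     else if r \<in> ?B then
       d2 r (xor_words w2 (drop p1 (e3 (restrict y ?C)))) (restrict y (out_nbhd D r \<inter> ?B))
     else
       d3 r (xor_words w1 (e1 (restrict y ?A)) @ xor_words w2 (e2 (restrict y ?B)))
         (restrict y (out_nbhd D r \<inter> ?C)))" for r w1 w2 y
  have "enc1 \<in> realizations M1 t \<rightarrow> words p1"
  proof
    fix x assume x: "x \<in> realizations M1 t"
    have "length (e1 (restrict x ?A)) = p1" "length (e3 (restrict x ?C)) = p1 + p2"
      using index_codeD(1)[OF c1 x] index_codeD(1)[OF c3 x] by auto
    then show "enc1 x \<in> words p1"
      by (simp add: enc1_def words_def)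
  qed
  moreover have "enc2 \<in> realizations M2 t \<rightarrow> words p2"
  proof
    fix x assume x: "x \<in> realizations M2 t"
    have "length (e2 (restrict x ?B)) = p2" "length (e3 (restrict x ?C)) = p1 + p2"
      using index_codeD(1)[OF c2 x] index_codeD(1)[OF c3 x] by auto
    then show "enc2 x \<in> words p2"
      by (simp add: enc2_def words_def)
  qed
  moreover have "dec r (enc1 (restrict x M1)) (enc2 (restrict x M2)) (restrict x (out_nbhd D r)) = x r"
    if x: "x \<in> realizations (verts D) t" and r: "r \<in> verts D" for x r
  proof -
    let ?y = "restrict x (out_nbhd D r)"
    define u1 u2 u3 where "u1 = e1 (restrict x ?A)" and "u2 = e2 (restrict x ?B)"
      and "u3 = e3 (restrict x ?C)"
    have sub: "?A \<subseteq> verts D" "?B \<subseteq> verts D" "?C \<subseteq> verts D"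
      using M by auto
    have len: "length u1 = p1" "length u2 = p2" "length u3 = p1 + p2"
      unfolding u1_def u2_def u3_def
      by (fact index_codeD(1)[OF c1 x sub(1)] index_codeD(1)[OF c2 x sub(2)]
          index_codeD(1)[OF c3 x sub(3)])+
    have "M1 \<inter> ?A = ?A" "M1 \<inter> ?C = ?C" "M2 \<inter> ?B = ?B" "M2 \<inter> ?C = ?C"
      by auto
    then have w: "enc1 (restrict x M1) = xor_words u1 (take p1 u3)"
      "enc2 (restrict x M2) = xor_words u2 (drop p1 u3)"
      by (simp_all add: enc1_def enc2_def u1_def u2_def u3_def)
    have y: "restrict ?y (out_nbhd D r \<inter> S) = restrict x (out_nbhd D r \<inter> S)" for S
      by (auto simp: restrict_def fun_eq_iff)
    have yS: "restrict ?y S = restrict x S" if "S \<subseteq> out_nbhd D r" for S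
      using that by (auto simp: restrict_def fun_eq_iff)
    consider "r \<in> ?A" | "r \<in> ?B" | "r \<in> ?C"
      using r M by auto
    then show ?thesis
    proof cases
      case 1
      have "xor_words (xor_words u1 (take p1 u3)) (take p1 u3) = u1"
        using len by (intro xor_words_cancel_right) simp
      moreover have "e3 (restrict ?y ?C) = u3"
        using yS[OF to3] 1 by (simp add: u3_def)
      ultimately have "dec r (enc1 (restrict x M1)) (enc2 (restrict x M2)) ?y =
          d1 r u1 (restrict x (out_nbhd D r \<inter> ?A))"
        using 1 unfolding dec_def w y by simp
      then show ?thesis
        using index_codeD(2)[OF c1 x sub(1) 1] by (simp add: u1_def)
    next
      case 2
      have "xor_words (xor_words u2 (drop p1 u3)) (drop p1 u3) = u2"
        using len by (intro xor_words_cancel_right) simp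
      moreover have "e3 (restrict ?y ?C) = u3"
        using yS[OF to3] 2 by (simp add: u3_def)
      ultimately have "dec r (enc1 (restrict x M1)) (enc2 (restrict x M2)) ?y =
          d2 r u2 (restrict x (out_nbhd D r \<inter> ?B))"
        using 2 unfolding dec_def w y by simp
      then show ?thesis
        using index_codeD(2)[OF c2 x sub(2) 2] by (simp add: u2_def)
    next
      case 3
      have "xor_words (xor_words u1 (take p1 u3)) u1 = take p1 u3"
        "xor_words (xor_words u2 (drop p1 u3)) u2 = drop p1 u3"
        using len by (auto intro!: xor_words_cancel_left)
      moreover have "e1 (restrict ?y ?A) = u1" "e2 (restrict ?y ?B) = u2"
        using yS[of ?A] yS[of ?B] from3[OF 3] by (simp_all add: u1_def u2_def)
      ultimately have "dec r (enc1 (restrict x M1)) (enc2 (restrict x M2)) ?y =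
          d3 r u3 (restrict x (out_nbhd D r \<inter> ?C))"
        using 3 unfolding dec_def w y by simp
      then show ?thesis
        using index_codeD(2)[OF c3 x sub(3) 3] by (simp add: u3_def)
    qed
  qed
  ultimately have "two_sender_index_code D M1 M2 t p1 p2 enc1 enc2 dec"
    by (simp add: two_sender_index_code_def)
  then show ?thesis by blast
qed

section \<open>The optimal two-sender length and the two identities\<close>

lemma two_sender_min_length:
  assumes "finite (verts D)" and M: "M1 \<union> M2 = verts D"
    and "\<And>r. r \<in> (M1 - M2) \<union> (M2 - M1) \<Longrightarrow> M1 \<inter> M2 \<subseteq> out_nbhd D r"
    and "\<And>r. r \<in> M1 \<inter> M2 \<Longrightarrow> (M1 - M2) \<union> (M2 - M1) \<subseteq> out_nbhd D r"
  shows "(LEAST p. \<exists>p1 p2 enc1 enc2 dec.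
        p = p1 + p2 \<and> two_sender_index_code D M1 M2 t p1 p2 enc1 enc2 dec) =
      max (min_length t (D \<restriction> (M1 \<inter> M2)))
        (min_length t (D \<restriction> (M1 - M2)) + min_length t (D \<restriction> (M2 - M1)))"
    (is "_ = max ?n3 (?n1 + ?n2)")
proof (rule Least_equality)
  \<comment> \<open>The first sender uses \<open>?n1\<close> bits and the second takes all the rest.
    The natural subtraction is exact since the maximum is at least \<open>?n1\<close>; moreover
    \<open>?p2\<close> is at least \<open>?n2\<close>, and \<open>?n1 + ?p2\<close> at least
    \<open>?n3\<close>, so padding applies.\<close>
  let ?p2 = "max ?n3 (?n1 + ?n2) - ?n1"
  have "finite (M1 \<union> M2)"
    using assms(1) M by simp
  then have "finite (verts (D \<restriction> (M1 - M2)))" "finite (verts (D \<restriction> (M2 - M1)))"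
    "finite (verts (D \<restriction> (M1 \<inter> M2)))"
    by auto
  then obtain e1 d1 e2 d2 e3 d3 where
    c: "index_code (D \<restriction> (M1 - M2)) t ?n1 e1 d1" "index_code (D \<restriction> (M2 - M1)) t ?n2 e2 d2"
      "index_code (D \<restriction> (M1 \<inter> M2)) t ?n3 e3 d3"
    by (meson ex_index_code_min_length)
  obtain e2' d2' where c2: "index_code (D \<restriction> (M2 - M1)) t ?p2 e2' d2'"
    using index_code_pad[OF c(2), of ?p2] by fastforce
  obtain e3' d3' where c3: "index_code (D \<restriction> (M1 \<inter> M2)) t (?n1 + ?p2) e3' d3'"
    using index_code_pad[OF c(3), of "?n1 + ?p2"] by fastforce
  obtain enc1 enc2 dec where "two_sender_index_code D M1 M2 t ?n1 ?p2 enc1 enc2 dec"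
    using two_sender_index_code_construct[OF c(1) c2 c3 M assms(3,4)] by blast
  moreover have "max ?n3 (?n1 + ?n2) = ?n1 + ?p2"
    by simp
  ultimately show "\<exists>p1 p2 enc1 enc2 dec. max ?n3 (?n1 + ?n2) = p1 + p2 \<and>
      two_sender_index_code D M1 M2 t p1 p2 enc1 enc2 dec"
    by blast
qed (use two_sender_index_code_lower M in blast)

lemma fully_participatedD:
  assumes "fully_participated D M1 M2" "(i, j) \<in> parcs (interaction_digraph D M1 M2)"
    "r \<in> part M1 M2 i"
  shows "part M1 M2 j \<subseteq> out_nbhd D r"
  using assms by (fastforce simp: fully_participated_def sub_digraph_def out_nbhd_def)

theorem theorem6:
  fixes D :: "(nat, 'e) pre_digraph" and N :: nat and M1 M2 :: "nat set"
  assumes "digraph D" and "verts D = {1..N}"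
    and "M1 \<union> M2 = verts D"
    and "fully_participated D M1 M2"
    and "{(1, 3), (3, 1), (2, 3), (3, 2)} \<subseteq> parcs (interaction_digraph D M1 M2)"
  shows "(\<forall>t\<ge>1. beta2_t t D M1 M2 =
            max (beta_t t (sub_digraph D M1 M2 3))
                (beta_t t (sub_digraph D M1 M2 1) + beta_t t (sub_digraph D M1 M2 2))) \<and>
         beta2 D M1 M2 =
            max (beta (sub_digraph D M1 M2 3))
                (beta (sub_digraph D M1 M2 1) + beta (sub_digraph D M1 M2 2))"
proof -
  have parts: "part M1 M2 1 = M1 - M2" "part M1 M2 2 = M2 - M1" "part M1 M2 3 = M1 \<inter> M2"
    by (simp_all add: part_def)
  have nbhd: "part M1 M2 j \<subseteq> out_nbhd D r"
    if "(i, j) \<in> {(1, 3), (3, 1), (2, 3), (3, 2)}" "r \<in> part M1 M2 i" for i j r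
    using fully_participatedD[OF assms(4)] assms(5) that by blast
  have to3: "M1 \<inter> M2 \<subseteq> out_nbhd D r" if "r \<in> (M1 - M2) \<union> (M2 - M1)" for r
    using that nbhd[of 1 3 r] nbhd[of 2 3 r] unfolding parts by blast
  have from3: "(M1 - M2) \<union> (M2 - M1) \<subseteq> out_nbhd D r" if "r \<in> M1 \<inter> M2" for r
    using that nbhd[of 3 1 r] nbhd[of 3 2 r] unfolding parts by blast
  have finD: "finite (verts D)"
    using assms(2) by simp
  have finV: "finite (verts (sub_digraph D M1 M2 i))" for i
    by (rule finite_subset[OF _ finD]) (use assms(3) in \<open>auto simp: sub_digraph_def part_def\<close>)
  have sub: "sub_digraph D M1 M2 1 = D \<restriction> (M1 - M2)" "sub_digraph D M1 M2 2 = D \<restriction> (M2 - M1)"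
    "sub_digraph D M1 M2 3 = D \<restriction> (M1 \<inter> M2)"
    unfolding sub_digraph_def parts by (rule refl)+
  \<comment> \<open>This covers \<open>t = 0\<close> too, where division by zero makes both sides
    \<open>0\<close>. Being unconditional, it can be used for rewriting under the infimum.\<close>
  have eq: "beta2_t t D M1 M2 =
      max (beta_t t (sub_digraph D M1 M2 3))
        (beta_t t (sub_digraph D M1 M2 1) + beta_t t (sub_digraph D M1 M2 2))" for t
    unfolding beta2_t_def beta_t_eq sub
    by (subst two_sender_min_length[OF finD assms(3) to3 from3])
      (simp_all add: of_nat_max max_divide_distrib_right add_divide_distrib)
  have "beta2 D M1 M2 =
      max (beta (sub_digraph D M1 M2 3))
        (beta (sub_digraph D M1 M2 1) + beta (sub_digraph D M1 M2 2))"
    unfolding beta2_def beta_def eq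
    by (rule INF_max_add_eq) (auto simp: beta_t_mult_le finV, simp_all add: beta_t_eq)
  with eq show ?thesis by blast
qed

end
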